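(* Let $A$ be a $C_\infty$-algebra over a field $\mathbb{K}$ and let $\alpha_1,\dots,\alpha_m\in\mathrm{H}(A)$ be homogeneous classes ($m\ge2$). Fix $r$ with $0<r<m$. Suppose for any $\sigma\in S_{r,m}$ and any $i,j=0,\dots,m$ with $0<j-i<m$, we have $\bar b_{j-i}(\alpha_{\sigma(i+1)},\dots,\alpha_{\sigma(j)})=0$. Then the Massey product of $\alpha_{\sigma(1)},\dots,\alpha_{\sigma(m)}$ is defined for any $\sigma\in S_{r,m}$ and we have $$0\in\sum_{\sigma\in S_{r,m}}(-1)^{\varepsilon(\sigma)}\langle\alpha_{\sigma(1)},\dots,\alpha_{\sigma(m)}\rangle$$ (sum of subsets of the vector space $\mathrm{H}(A)$).
   Context: $A_\infty$-algebra: a $\mathbb{Z}$- or $\mathbb{Z}_2$-graded $\mathbb{K}$-vector space $A$ with graded multilinear maps $b_n\colon A^{\otimes n}\to A$ ($n\ge1$) of degree $1$ such that for each $n\ge1$, $\sum_{r,t\ge0,\,s\ge1,\,r+s+t=n}b_{r+1+t}\circ(1^{\otimes r}\otimes b_s\otimes1^{\otimes t})=0$ (Koszul sign rule $(f\otimes g)(x\otimes y)=(-1)^{|g||x|}f(x)\otimes g(y)$). $\mathrm{H}(A)$ is the cohomology of $(A,b_1)$. $S_{r,n}$ ($0<r<n$) is the set of permutations $\sigma$ of $\{1,\dots,n\}$ such that in the word $\sigma(1)\cdots\sigma(n)$ the letters $1,\dots,r$ appear in increasing order and the letters $r+1,\dots,n$ appear in increasing order. For homogeneous $a_1,\dots,a_n$,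 $\varepsilon(\sigma)=\sum|a_i||a_j|$ over pairs $i\le r<j$ such that $j$ appears before $i$ in that word (in the claim, $|a_i|=|\alpha_i|$). The shuffle product on $\overline TA=\bigoplus_{n\ge1}A^{\otimes n}$ is $[a_1\otimes\cdots\otimes a_r]\Join[a_{r+1}\otimes\cdots\otimes a_n]=\sum_{\sigma\in S_{r,n}}(-1)^{\varepsilon(\sigma)}a_{\sigma(1)}\otimes\cdots\otimes a_{\sigma(n)}$. A $C_\infty$-algebra is an $A_\infty$-algebra such that for each $n\ge2$, $b_n$ vanishes on (the part in $A^{\otimes n}$ of) $\overline TA\Join\overline TA$. A morphism $f\colon A\to B$ of $A_\infty$-algebras is a family of multilinear maps $f_n\colon A^{\otimes n}\to B$ of degree $0$ with, for each $n\ge1$, $\sum_{r,t\ge0,\,s\ge1,\,r+s+t=n}f_{r+1+t}\circ(1^{\otimes r}\otimes b^A_s\otimes1^{\otimes t})=\sum_{i_1+\cdots+i_r=n,\,i_j>0}b^B_r\circ(f_{i_1}\otimes\cdots\otimes f_{i_r})$; it is a quasi-isomorphism if $f_1$ is one. $\{\bar b_n\}$ denotes the transferred $A_\infty$-structure on $\mathrm{H}(A)$: $\bar b_1=0$, $\bar b_2$ is induced by $b_2$, and there is an $A_\infty$-quasi-isomorphism $q\colon(\mathrm{H}(A),\{\bar b_n\})\to A$ such that $q_1(\alpha)$ is a closed representative of $\alpha$ for all $\alpha$; as $A$ is a $C_\infty$-algebra, the transferred structure $(\mathrm{H}(A),\{\bar b_n\})$ is a $C_\infty$-algebra (a known fact,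 taken as part of the data). Massey products: $\mathrm{Mat}^{(m+1)}_+(A)$ is the space of strictly upper-triangular matrices $\mathbf{a}=(a_{ij})_{0\le i,j\le m}$ with entries in $A$; $(\mathbf{a}\odot\mathbf{b})_{ij}=\sum_ka_{ik}\otimes b_{kj}$ (no signs); $b_n$ acts component-wise; $\partial_{\mathbf{a}}\mathbf{a}=\sum_{n\ge1}b_n(\underbrace{\mathbf{a}\odot\cdots\odot\mathbf{a}}_n)$ (a finite sum). $\mathbf{a}$ is a defining system for $\beta_1,\dots,\beta_m\in\mathrm{H}(A)$ if $(\partial_{\mathbf{a}}\mathbf{a})_{ij}=0$ for all $(i,j)\ne(0,m)$ and each $\beta_i$ is represented by the (then closed) element $a_{i-1,i}$; $\mu(\mathbf{a})=(\partial_{\mathbf{a}}\mathbf{a})_{0m}$ is $b_1$-closed. The Massey product is defined if a defining system exists, and $\langle\beta_1,\dots,\beta_m\rangle\subset\mathrm{H}(A)$ is the set of all classes $[\mu(\mathbf{a})]$ over defining systems $\mathbf{a}$. *)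

theory Defs
  imports "HOL-Algebra.Module" "HOL-Algebra.AbelCoset" "HOL-Combinatorics.Permutations"
begin

section \<open>Graded vector spaces\<close>

record ('k, 'a) graded_module = "('k, 'a) module" +
  grade :: "int \<Rightarrow> 'a set"

text \<open>
  Both kinds of grading are treated at once: degrees are integers taken modulo \<open>N\<close>, where
  \<open>N = 0\<close> is a \<open>\<int>\<close>-grading and \<open>N = 2\<close> a \<open>\<int>\<^sub>2\<close>-grading.  As \<open>x mod 0 = x\<close>, the
  degrees are represented by the integers fixed by \<open>mod N\<close> (all of them, or \<open>{0, 1}\<close>).
  The components of \<open>module\<close> inherited from \<open>monoid\<close> (\<open>mult\<close> and \<open>one\<close>) play no role.
\<close>

definition graded_vector_space ::
    "('k, 'c) ring_scheme \<Rightarrow> int \<Rightarrow> ('k, 'a) graded_module \<Rightarrow> bool" where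
  "graded_vector_space K N V \<longleftrightarrow>
     field K \<and> module K V \<and> (N = 0 \<or> N = 2) \<and>
     (\<forall>d. submodule (grade V d) K V) \<and>
     (\<forall>d. grade V (d mod N) = grade V d) \<and>
     (\<forall>x \<in> carrier V. \<exists>!c. (\<forall>d. c d \<in> grade V d) \<and> (\<forall>d. d mod N \<noteq> d \<longrightarrow> c d = \<zero>\<^bsub>V\<^esub>) \<and>
        finite {d. c d \<noteq> \<zero>\<^bsub>V\<^esub>} \<and> x = finsum V c {d. c d \<noteq> \<zero>\<^bsub>V\<^esub>})"

definition homogeneous_word :: "('k, 'a) graded_module \<Rightarrow> int list \<Rightarrow> 'a list \<Rightarrow> bool" where
  "homogeneous_word V ds xs \<longleftrightarrow> list_all2 (\<lambda>x d. x \<in> grade V d) xs ds"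

definition sgn_pow :: "('k, 'a) graded_module \<Rightarrow> int \<Rightarrow> 'a \<Rightarrow> 'a" where
  "sgn_pow V e x = (if even e then x else \<ominus>\<^bsub>V\<^esub> x)"

section \<open>Families of graded multilinear maps\<close>

text \<open>
  A family of linear maps \<open>f\<^sub>n : V\<^sup>\<otimes>\<^sup>n \<rightarrow> W\<close>, \<open>n \<ge> 1\<close>, is a single function \<open>f\<close> on lists, \<open>f\<^sub>n\<close> being
  the multilinear restriction of \<open>f\<close> to lists of length \<open>n\<close>; the value at \<open>[]\<close> is irrelevant.
\<close>

definition multilinear_family ::
    "('k, 'c) ring_scheme \<Rightarrow> ('k, 'a) graded_module \<Rightarrow> ('k, 'b) graded_module
      \<Rightarrow> ('a list \<Rightarrow> 'b) \<Rightarrow> bool" where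
  "multilinear_family K V W f \<longleftrightarrow>
     (\<forall>xs. xs \<noteq> [] \<and> set xs \<subseteq> carrier V \<longrightarrow> f xs \<in> carrier W) \<and>
     (\<forall>us vs x y. set us \<subseteq> carrier V \<and> set vs \<subseteq> carrier V \<and> x \<in> carrier V \<and> y \<in> carrier V \<longrightarrow>
        f (us @ [x \<oplus>\<^bsub>V\<^esub> y] @ vs) = f (us @ [x] @ vs) \<oplus>\<^bsub>W\<^esub> f (us @ [y] @ vs)) \<and>
     (\<forall>us vs c x. set us \<subseteq> carrier V \<and> set vs \<subseteq> carrier V \<and> c \<in> carrier K \<and> x \<in> carrier V \<longrightarrow>
        f (us @ [c \<odot>\<^bsub>V\<^esub> x] @ vs) = c \<odot>\<^bsub>W\<^esub> f (us @ [x] @ vs))"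

definition family_of_degree ::
    "int \<Rightarrow> ('k, 'a) graded_module \<Rightarrow> ('k, 'b) graded_module \<Rightarrow> ('a list \<Rightarrow> 'b) \<Rightarrow> bool" where
  "family_of_degree e V W f \<longleftrightarrow>
     (\<forall>ds xs. xs \<noteq> [] \<and> homogeneous_word V ds xs \<longrightarrow> f xs \<in> grade W (sum_list ds + e))"

text \<open>
  The sum of all \<open>f\<^sub>r\<^sub>+\<^sub>1\<^sub>+\<^sub>t \<circ> (1\<^sup>\<otimes>\<^sup>r \<otimes> b\<^sub>s \<otimes> 1\<^sup>\<otimes>\<^sup>t)\<close> with \<open>r + s + t = n\<close>, evaluated at a word \<open>xs\<close> of
  length \<open>n\<close> whose letters have degrees \<open>ds\<close>.  As \<open>b\<^sub>s\<close> has degree \<open>1\<close>, moving it past the first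
  \<open>r\<close> letters produces the Koszul sign.
\<close>

definition insertion_sum ::
    "('k, 'b) graded_module \<Rightarrow> ('a list \<Rightarrow> 'b) \<Rightarrow> ('a list \<Rightarrow> 'a) \<Rightarrow> int list \<Rightarrow> 'a list \<Rightarrow> 'b" where
  "insertion_sum W f b ds xs =
     finsum W
       (\<lambda>(r, s, t). sgn_pow W (sum_list (take r ds))
          (f (take r xs @ [b (take s (drop r xs))] @ drop (r + s) xs)))
       {(r, s, t). 1 \<le> s \<and> r + s + t = length xs}"

section \<open>\<open>A\<^sub>\<infinity>\<close>- and \<open>C\<^sub>\<infinity>\<close>-algebras\<close>

definition A_infinity ::
    "('k, 'c) ring_scheme \<Rightarrow> int \<Rightarrow> ('k, 'a) graded_module \<Rightarrow> ('a list \<Rightarrow> 'a) \<Rightarrow> bool" where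
  "A_infinity K N V b \<longleftrightarrow>
     graded_vector_space K N V \<and> multilinear_family K V V b \<and> family_of_degree 1 V V b \<and>
     (\<forall>ds xs. xs \<noteq> [] \<and> homogeneous_word V ds xs \<longrightarrow> insertion_sum V b b ds xs = \<zero>\<^bsub>V\<^esub>)"

text \<open>In the word \<open>\<sigma> 1, \<dots>, \<sigma> n\<close>, the letter \<open>i\<close> stands at position \<open>inv \<sigma> i\<close>.\<close>

definition shuffle_perms :: "nat \<Rightarrow> nat \<Rightarrow> (nat \<Rightarrow> nat) set" where
  "shuffle_perms r n = {\<sigma>. \<sigma> permutes {1..n} \<and>
     (\<forall>i j. 1 \<le> i \<and> i < j \<and> j \<le> r \<longrightarrow> Hilbert_Choice.inv \<sigma> i < Hilbert_Choice.inv \<sigma> j) \<and>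
     (\<forall>i j. r + 1 \<le> i \<and> i < j \<and> j \<le> n \<longrightarrow> Hilbert_Choice.inv \<sigma> i < Hilbert_Choice.inv \<sigma> j)}"

definition shuffle_exponent :: "nat \<Rightarrow> nat \<Rightarrow> (nat \<Rightarrow> int) \<Rightarrow> (nat \<Rightarrow> nat) \<Rightarrow> int" where
  "shuffle_exponent r n d \<sigma> =
     (\<Sum>(i, j) \<in> {(i, j). 1 \<le> i \<and> i \<le> r \<and> r < j \<and> j \<le> n \<and> 
        Hilbert_Choice.inv \<sigma> j < Hilbert_Choice.inv \<sigma> i}. d i * d j)"

text \<open>
  By multilinearity it suffices that \<open>b\<^sub>n\<close> vanishes on the shuffle products of pure tensors with
  homogeneous entries, which span the part of the image of the shuffle product in \<open>V\<^sup>\<otimes>\<^sup>n\<close>.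
\<close>

definition C_infinity ::
    "('k, 'c) ring_scheme \<Rightarrow> int \<Rightarrow> ('k, 'a) graded_module \<Rightarrow> ('a list \<Rightarrow> 'a) \<Rightarrow> bool" where
  "C_infinity K N V b \<longleftrightarrow>
     A_infinity K N V b \<and>
     (\<forall>n r a d. 2 \<le> n \<and> 0 < r \<and> r < n \<and> (\<forall>i \<in> {1..n}. a i \<in> grade V (d i)) \<longrightarrow>
        finsum V
          (\<lambda>\<sigma>. sgn_pow V (shuffle_exponent r n d \<sigma>) (b (map (\<lambda>i. a (\<sigma> i)) [1..<Suc n])))
          (shuffle_perms r n) = \<zero>\<^bsub>V\<^esub>)"

section \<open>Cohomology\<close>

definition cocycles :: "('k, 'a) graded_module \<Rightarrow> ('a list \<Rightarrow> 'a) \<Rightarrow> 'a set" where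
  "cocycles V b = {x \<in> carrier V. b [x] = \<zero>\<^bsub>V\<^esub>}"

definition coboundaries :: "('k, 'a) graded_module \<Rightarrow> ('a list \<Rightarrow> 'a) \<Rightarrow> 'a set" where
  "coboundaries V b = (\<lambda>x. b [x]) ` carrier V"

definition coh_class :: "('k, 'a) graded_module \<Rightarrow> ('a list \<Rightarrow> 'a) \<Rightarrow> 'a \<Rightarrow> 'a set" where
  "coh_class V b z = coboundaries V b +>\<^bsub>V\<^esub> z"

definition cohomology ::
    "('k, 'a) graded_module \<Rightarrow> ('a list \<Rightarrow> 'a) \<Rightarrow> ('k, 'a set) graded_module" where
  "cohomology V b =
     \<lparr>carrier = coh_class V b ` cocycles V b,
      monoid.mult = undefined, one = undefined,
      zero = coboundaries V b,
      add = set_add V,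
      smult = (\<lambda>c X. \<Union>x\<in>X. coh_class V b (c \<odot>\<^bsub>V\<^esub> x)),
      grade = (\<lambda>d. coh_class V b ` (cocycles V b \<inter> grade V d))\<rparr>"

definition induced_map ::
    "('k, 'b) graded_module \<Rightarrow> ('b list \<Rightarrow> 'b) \<Rightarrow> ('a list \<Rightarrow> 'b) \<Rightarrow> 'a set \<Rightarrow> 'b set" where
  "induced_map W bW f X = (\<Union>x\<in>X. coh_class W bW (f [x]))"

section \<open>Morphisms and the transferred structure\<close>

fun blocks :: "nat list \<Rightarrow> 'a list \<Rightarrow> 'a list list" where
  "blocks [] xs = []"
| "blocks (i # is) xs = take i xs # blocks is (drop i xs)"

definition compositions :: "nat \<Rightarrow> nat list set" where
  "compositions n = {is. (\<forall>i \<in> set is. 0 < i) \<and> sum_list is = n}"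

definition A_infinity_morphism ::
    "('k, 'c) ring_scheme \<Rightarrow> ('k, 'a) graded_module \<Rightarrow> ('a list \<Rightarrow> 'a)
      \<Rightarrow> ('k, 'b) graded_module \<Rightarrow> ('b list \<Rightarrow> 'b) \<Rightarrow> ('a list \<Rightarrow> 'b) \<Rightarrow> bool" where
  "A_infinity_morphism K V bV W bW f \<longleftrightarrow>
     multilinear_family K V W f \<and> family_of_degree 0 V W f \<and>
     (\<forall>ds xs. xs \<noteq> [] \<and> homogeneous_word V ds xs \<longrightarrow>
        insertion_sum W f bV ds xs =
          finsum W (\<lambda>is. bW (map f (blocks is xs))) (compositions (length xs)))"

definition A_infinity_quasi_iso ::
    "('k, 'c) ring_scheme \<Rightarrow> ('k, 'a) graded_module \<Rightarrow> ('a list \<Rightarrow> 'a)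
      \<Rightarrow> ('k, 'b) graded_module \<Rightarrow> ('b list \<Rightarrow> 'b) \<Rightarrow> ('a list \<Rightarrow> 'b) \<Rightarrow> bool" where
  "A_infinity_quasi_iso K V bV W bW f \<longleftrightarrow>
     A_infinity_morphism K V bV W bW f \<and>
     bij_betw (induced_map W bW f) (carrier (cohomology V bV)) (carrier (cohomology W bW))"

text \<open>
  The transferred structure is only determined up to isomorphism; this predicate says that \<open>bb\<close> is
  one.  That it is again \<open>C\<^sub>\<infinity>\<close>, a known theorem if \<open>(A, b)\<close> is \<open>C\<^sub>\<infinity>\<close>, is part of the data.
\<close>

definition transferred_C_infinity ::
    "('k, 'c) ring_scheme \<Rightarrow> int \<Rightarrow> ('k, 'a) graded_module \<Rightarrow> ('a list \<Rightarrow> 'a)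
      \<Rightarrow> ('a set list \<Rightarrow> 'a set) \<Rightarrow> bool" where
  "transferred_C_infinity K N A b bb \<longleftrightarrow>
     C_infinity K N (cohomology A b) bb \<and>
     (\<forall>\<alpha> \<in> carrier (cohomology A b). bb [\<alpha>] = \<zero>\<^bsub>cohomology A b\<^esub>) \<and>
     (\<forall>x \<in> cocycles A b. \<forall>y \<in> cocycles A b.
        bb [coh_class A b x, coh_class A b y] = coh_class A b (b [x, y])) \<and>
     (\<exists>q. A_infinity_quasi_iso K (cohomology A b) bb A b q \<and>
        (\<forall>\<alpha> \<in> carrier (cohomology A b). q [\<alpha>] \<in> cocycles A b \<and> coh_class A b (q [\<alpha>]) = \<alpha>))"

section \<open>Massey products\<close>

text \<open>Matrices are indexed by \<open>0, \<dots>, m\<close>; entries outside this range are ignored.\<close>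

definition strict_upper_matrix :: "('k, 'a) graded_module \<Rightarrow> nat \<Rightarrow> (nat \<Rightarrow> nat \<Rightarrow> 'a) \<Rightarrow> bool" where
  "strict_upper_matrix A m a \<longleftrightarrow>
     (\<forall>i \<le> m. \<forall>j \<le> m. a i j \<in> carrier A \<and> (j \<le> i \<longrightarrow> a i j = \<zero>\<^bsub>A\<^esub>))"

text \<open>
  The \<open>(i, j)\<close> entry of the \<open>n\<close>-fold product of \<open>a\<close> under \<open>\<odot>\<close> is the sum of
  \<open>a i k\<^sub>1 \<otimes> a k\<^sub>1 k\<^sub>2 \<otimes> \<dots> \<otimes> a k\<^sub>n\<^sub>-\<^sub>1 j\<close> over all intermediate indices, and \<open>b\<^sub>n\<close> is applied to it
  linearly.  These products vanish for \<open>n > m\<close> by strict upper triangularity.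
\<close>

definition matrix_op ::
    "('k, 'a) graded_module \<Rightarrow> ('a list \<Rightarrow> 'a) \<Rightarrow> nat \<Rightarrow> nat \<Rightarrow> (nat \<Rightarrow> nat \<Rightarrow> 'a)
      \<Rightarrow> nat \<Rightarrow> nat \<Rightarrow> 'a" where
  "matrix_op A b m n a i j =
     finsum A (\<lambda>ks. b (map2 a (i # ks) (ks @ [j]))) {ks. set ks \<subseteq> {0..m} \<and> length ks = n - 1}"

definition matrix_diff ::
    "('k, 'a) graded_module \<Rightarrow> ('a list \<Rightarrow> 'a) \<Rightarrow> nat \<Rightarrow> (nat \<Rightarrow> nat \<Rightarrow> 'a) \<Rightarrow> nat \<Rightarrow> nat \<Rightarrow> 'a" where
  "matrix_diff A b m a i j = finsum A (\<lambda>n. matrix_op A b m n a i j) {1..m}"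

definition defining_system ::
    "('k, 'a) graded_module \<Rightarrow> ('a list \<Rightarrow> 'a) \<Rightarrow> nat \<Rightarrow> (nat \<Rightarrow> 'a set)
      \<Rightarrow> (nat \<Rightarrow> nat \<Rightarrow> 'a) \<Rightarrow> bool" where
  "defining_system A b m \<beta> a \<longleftrightarrow>
     strict_upper_matrix A m a \<and>
     (\<forall>i \<le> m. \<forall>j \<le> m. (i, j) \<noteq> (0, m) \<longrightarrow> matrix_diff A b m a i j = \<zero>\<^bsub>A\<^esub>) \<and>
     (\<forall>i \<in> {1..m}. coh_class A b (a (i - 1) i) = \<beta> i)"

definition massey_defined ::
    "('k, 'a) graded_module \<Rightarrow> ('a list \<Rightarrow> 'a) \<Rightarrow> nat \<Rightarrow> (nat \<Rightarrow> 'a set) \<Rightarrow> bool" where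
  "massey_defined A b m \<beta> \<longleftrightarrow> (\<exists>a. defining_system A b m \<beta> a)"

definition massey_product ::
    "('k, 'a) graded_module \<Rightarrow> ('a list \<Rightarrow> 'a) \<Rightarrow> nat \<Rightarrow> (nat \<Rightarrow> 'a set) \<Rightarrow> 'a set set" where
  "massey_product A b m \<beta> = {coh_class A b (matrix_diff A b m a 0 m) | a. defining_system A b m \<beta> a}"

definition sum_of_subsets ::
    "('k, 'h) graded_module \<Rightarrow> ('i \<Rightarrow> 'h set) \<Rightarrow> 'i set \<Rightarrow> 'h set" where
  "sum_of_subsets H M I = {finsum H h I | h. \<forall>i \<in> I. h i \<in> M i}"

end

theory Submission
  imports Defs
begin

text \<open>
  Let \<open>q\<close> be the quasi-isomorphism from the transferred structure on cohomology to \<open>A\<close>.  A word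
  \<open>\<beta> 1, \<dots>, \<beta> m\<close> of classes all of whose proper factors are killed by the transferred operations
  \<open>bb\<close> has a canonical defining system, with entries \<open>q [\<beta> (i + 1), \<dots>, \<beta> j]\<close>.  Indeed the paths
  \<open>i < k\<^sub>1 < \<dots> < j\<close> that index the \<open>(i, j)\<close> entry of the twisted differential are the same thing as
  the compositions of \<open>j - i\<close>, so that this entry is the right hand side of the morphism equation
  for \<open>q\<close> at the word \<open>\<beta> (i + 1), \<dots>, \<beta> j\<close>.  On the left hand side of that equation every term
  applies \<open>bb\<close> to a factor of the word, hence vanishes unless the factor is the full word of length
  \<open>m\<close>; what is left in that case is \<open>q [bb [\<beta> 1, \<dots>, \<beta> m]]\<close>, a cocycle in the class
  \<open>bb [\<beta> 1, \<dots>, \<beta> m]\<close>.  This class is therefore an element of the Massey product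
  (\<open>transferred_product_in_massey_product\<close>).

  Choosing this element for every shuffle \<open>\<sigma>\<close> of \<open>\<alpha>\<close>, the signed sum of the choices is the value of
  \<open>bb\<close> on a shuffle product, which is zero because the transferred structure is \<open>C\<^sub>\<infinity>\<close>.
\<close>

section \<open>Multilinear families on words with a zero letter\<close>

lemma multilinear_family_carrier:
  assumes "multilinear_family K V W f" "xs \<noteq> []" "set xs \<subseteq> carrier V"
  shows "f xs \<in> carrier W"
  using assms unfolding multilinear_family_def by blast

text \<open>The zero letter is a multiple of itself by the scalar zero, which can be pulled out.\<close>

lemma multilinear_family_zero:
  assumes "module K V" "module K W" "multilinear_family K V W f"
    and "set xs \<subseteq> carrier V" "\<zero>\<^bsub>V\<^esub> \<in> set xs"
  shows "f xs = \<zero>\<^bsub>W\<^esub>"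
proof -
  interpret V: module K V by fact
  interpret W: module K W by fact
  obtain us vs where xs: "xs = us @ [\<zero>\<^bsub>V\<^esub>] @ vs"
    using assms(5) by (metis append_Cons append_Nil split_list)
  have "f (us @ [\<zero>\<^bsub>K\<^esub> \<odot>\<^bsub>V\<^esub> \<zero>\<^bsub>V\<^esub>] @ vs) = \<zero>\<^bsub>K\<^esub> \<odot>\<^bsub>W\<^esub> f (us @ [\<zero>\<^bsub>V\<^esub>] @ vs)"
    using assms(3,4) xs V.R.zero_closed V.zero_closed unfolding multilinear_family_def
    by (metis Un_subset_iff set_append)
  moreover have "f xs \<in> carrier W"
    using multilinear_family_carrier[OF assms(3)] assms(4) xs by blast
  ultimately show ?thesis using xs by simp
qed

section \<open>Paths and compositions\<close>

fun gaps :: "nat \<Rightarrow> nat list \<Rightarrow> nat \<Rightarrow> nat list" where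
  "gaps i [] j = [j - i]"
| "gaps i (k # ks) j = (k - i) # gaps k ks j"

text \<open>
  Only the intermediate indices are listed, as in the sums that define the entries of a matrix
  product.
\<close>

definition paths :: "nat \<Rightarrow> nat \<Rightarrow> nat list set" where
  "paths i j = {ks. sorted_wrt (<) (i # ks @ [j])}"

lemma path_less: "ks \<in> paths i j \<Longrightarrow> i < j"
  by (simp add: paths_def)

lemma path_tail: "k # ks \<in> paths i j \<Longrightarrow> i < k \<and> k < j \<and> ks \<in> paths k j"
  by (auto simp: paths_def)

lemma path_length: "ks \<in> paths i j \<Longrightarrow> length ks < j - i"
proof (induction ks arbitrary: i)
  case Nil
  then show ?case using path_less by simp
next
  case (Cons k ks)
  have "i < k" "k < j" "ks \<in> paths k j" using path_tail[OF Cons.prems] by auto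
  then show ?case using Cons.IH[of k] by simp
qed

lemma gaps_not_Nil: "gaps i ks j \<noteq> []"
  by (cases ks) auto

lemma gaps_in_compositions: "ks \<in> paths i j \<Longrightarrow> gaps i ks j \<in> compositions (j - i)"
proof (induction ks arbitrary: i)
  case Nil
  then show ?case using path_less by (simp add: compositions_def)
next
  case (Cons k ks)
  then show ?case using path_tail[OF Cons.prems] Cons.IH[of k] by (auto simp: compositions_def)
qed

lemma gaps_inj: "ks \<in> paths i j \<Longrightarrow> ls \<in> paths i j \<Longrightarrow> gaps i ks j = gaps i ls j \<Longrightarrow> ks = ls"
proof (induction ks arbitrary: i ls)
  case Nil
  then show ?case
    by (cases ls) (auto simp: gaps_not_Nil[symmetric])
next
  case (Cons k ks)
  show ?case
  proof (cases ls)
    case Nil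
    then show ?thesis using Cons.prems by (auto simp: gaps_not_Nil)
  next
    case (Cons l ls')
    then have "k = l"
      using Cons.prems path_tail[OF Cons.prems(1)] path_tail[of l ls' i j] by auto
    then show ?thesis
      using Cons Cons.prems Cons.IH[of k ls'] path_tail[of k ks i j] path_tail[of l ls' i j] by auto
  qed
qed

lemma gaps_surj:
  "is \<in> compositions (j - i) \<Longrightarrow> i < j \<Longrightarrow> \<exists>ks \<in> paths i j. gaps i ks j = is"
proof (induction "is" arbitrary: i)
  case Nil
  then show ?case by (simp add: compositions_def)
next
  case (Cons x "is")
  show ?case
  proof (cases "is = []")
    case True
    then show ?thesis using Cons.prems
      by (intro bexI[of _ "[]"]) (auto simp: compositions_def paths_def)
  next
    case False
    then have "0 < sum_list is" "0 < x" "x + sum_list is = j - i" "\<forall>y \<in> set is. 0 < y"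
      using Cons.prems by (auto simp: compositions_def neq_Nil_conv)
    then have "is \<in> compositions (j - (i + x))" "i + x < j"
      by (auto simp: compositions_def)
    then obtain ks where ks: "ks \<in> paths (i + x) j" "gaps (i + x) ks j = is"
      using Cons.IH by blast
    then have "(i + x) # ks \<in> paths i j"
      using \<open>0 < x\<close> \<open>i + x < j\<close> by (auto simp: paths_def)
    then show ?thesis using ks by (intro bexI[of _ "(i + x) # ks"]) auto
  qed
qed

text \<open>
  A path is recovered from the lengths of its steps by partial summation, and every sequence of
  positive steps of the right total length arises.
\<close>

lemma gaps_bij: "i < j \<Longrightarrow> bij_betw (\<lambda>ks. gaps i ks j) (paths i j) (compositions (j - i))"
  using gaps_surj[of _ j i]
  by (auto simp: bij_betw_def inj_on_def gaps_in_compositions dest: gaps_inj)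

text \<open>
  Each step of a path cuts off the next block, so that the blocks are the factors that define the
  entries of \<open>a\<close> along the path.
\<close>

lemma map_blocks_gaps:
  assumes "ks \<in> paths i j"
    and "\<And>k l. i \<le> k \<Longrightarrow> k < l \<Longrightarrow> a k l = q (map \<beta> [Suc k..<Suc l])"
  shows "map q (blocks (gaps i ks j) (map \<beta> [Suc i..<Suc j])) = map2 a (i # ks) (ks @ [j])"
  using assms
proof (induction ks arbitrary: i)
  case Nil
  have "i < j" using path_less[OF Nil.prems(1)] .
  then show ?case using Nil.prems(2)[of i j] by (simp del: upt_Suc)
next
  case (Cons k ks)
  have k: "i < k" "k < j" "ks \<in> paths k j" using path_tail[OF Cons.prems(1)] by auto
  have "take (k - i) (map \<beta> [Suc i..<Suc j]) = map \<beta> [Suc i..<Suc k]"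
    using k by (simp add: take_map del: upt_Suc)
  moreover have "drop (k - i) (map \<beta> [Suc i..<Suc j]) = map \<beta> [Suc k..<Suc j]"
    using k by (simp add: drop_map del: upt_Suc)
  ultimately show ?case
    using k Cons.IH[of k] Cons.prems(2) by (simp del: upt_Suc)
qed

section \<open>The twisted differential as a sum over compositions\<close>

text \<open>
  A step that does not increase reads an entry on or below the diagonal; this eliminates all index
  sequences other than paths from the products of a strictly upper triangular matrix.
\<close>

lemma zero_entry_on_non_path:
  assumes "\<And>k l. k \<le> m \<Longrightarrow> l \<le> m \<Longrightarrow> l \<le> k \<Longrightarrow> a k l = z"
    and "set ks \<subseteq> {0..m}" "i \<le> m" "j \<le> m" "ks \<notin> paths i j"
  shows "z \<in> set (map2 a (i # ks) (ks @ [j]))"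
  using assms(2-)
proof (induction ks arbitrary: i)
  case Nil
  then show ?case using assms(1)[of i j] by (auto simp: paths_def)
next
  case (Cons k ks)
  show ?case
  proof (cases "k \<le> i")
    case True
    then show ?thesis using Cons.prems assms(1)[of i k] by auto
  next
    case False
    then have "ks \<notin> paths k j"
      using Cons.prems(4) by (force simp: paths_def)
    then show ?thesis using Cons.IH[of k] Cons.prems by auto
  qed
qed

lemma set_map2_subset:
  assumes "\<And>k l. k \<in> X \<Longrightarrow> l \<in> Y \<Longrightarrow> a k l \<in> C" "set xs \<subseteq> X" "set ys \<subseteq> Y"
  shows "set (map2 a xs ys) \<subseteq> C"
  using assms by (fastforce dest: set_zip_leftD set_zip_rightD)

text \<open>
  The double sum over the arity \<open>n\<close> and the \<open>n - 1\<close> intermediate indices is a single sum over all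
  sequences of fewer than \<open>m\<close> indices.  Those that are not paths contribute zero, and no path is
  lost, since the intermediate indices of a path increase strictly between \<open>i\<close> and \<open>j \<le> m\<close>.
\<close>

lemma matrix_diff_eq_sum_paths:
  assumes "module K A" "multilinear_family K A A b" "strict_upper_matrix A m a"
    and "i \<le> m" "j \<le> m"
  shows "matrix_diff A b m a i j =
    finsum A (\<lambda>ks. b (map2 a (i # ks) (ks @ [j]))) (paths i j)"
proof -
  interpret A: module K A by fact
  let ?g = "\<lambda>ks. b (map2 a (i # ks) (ks @ [j]))"
  let ?S = "\<lambda>n. {ks. set ks \<subseteq> {0..m} \<and> length ks = n - 1}"
  have letters: "set (map2 a (i # ks) (ks @ [j])) \<subseteq> carrier A" if "set ks \<subseteq> {0..m}" for ks
    by (rule set_map2_subset[of "{0..m}" "{0..m}"])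
      (use that assms(3-5) in \<open>auto simp: strict_upper_matrix_def\<close>)
  have g: "?g ks \<in> carrier A" if "set ks \<subseteq> {0..m}" for ks
    by (rule multilinear_family_carrier[OF assms(2) _ letters[OF that]]) (cases ks; simp)
  have "matrix_diff A b m a i j = finsum A (\<lambda>n. finsum A ?g (?S n)) {1..m}"
    by (simp add: matrix_diff_def matrix_op_def)
  also have "\<dots> = finsum A ?g (\<Union>n\<in>{1..m}. ?S n)"
    by (rule A.add.finprod_UN_disjoint[symmetric])
      (auto simp: finite_lists_length_eq disjnt_def pairwise_def intro!: g)
  also have "\<dots> = finsum A ?g (paths i j)"
  proof (rule A.add.finprod_mono_neutral_cong_right)
    show "finite (\<Union>n\<in>{1..m}. ?S n)"
      by (auto simp: finite_lists_length_eq)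
    show "paths i j \<subseteq> (\<Union>n\<in>{1..m}. ?S n)"
    proof
      fix ks assume ks: "ks \<in> paths i j"
      then have "length ks < m" using path_length[OF ks] assms(5) by simp
      moreover have "set ks \<subseteq> {0..m}"
        using ks assms(5) by (force simp: paths_def sorted_wrt_append)
      ultimately show "ks \<in> (\<Union>n\<in>{1..m}. ?S n)"
        by (intro UN_I[of "Suc (length ks)"]) auto
    qed
    show "?g ks = \<zero>\<^bsub>A\<^esub>" if "ks \<in> (\<Union>n\<in>{1..m}. ?S n) - paths i j" for ks
    proof (rule multilinear_family_zero[OF assms(1,1,2)])
      have ks: "set ks \<subseteq> {0..m}" "ks \<notin> paths i j" using that by auto
      show "set (map2 a (i # ks) (ks @ [j])) \<subseteq> carrier A" by (rule letters[OF ks(1)])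
      show "\<zero>\<^bsub>A\<^esub> \<in> set (map2 a (i # ks) (ks @ [j]))"
        by (rule zero_entry_on_non_path[OF _ ks(1) assms(4,5) ks(2)])
          (use assms(3) in \<open>auto simp: strict_upper_matrix_def\<close>)
    qed
  qed (auto intro: g)
  finally show ?thesis .
qed

section \<open>The defining system given by a morphism\<close>

definition factor_matrix ::
    "('k, 'a) graded_module \<Rightarrow> ('h list \<Rightarrow> 'a) \<Rightarrow> (nat \<Rightarrow> 'h) \<Rightarrow> nat \<Rightarrow> nat \<Rightarrow> 'a" where
  "factor_matrix A q \<beta> i j = (if i < j then q (map \<beta> [Suc i..<Suc j]) else \<zero>\<^bsub>A\<^esub>)"

lemma strict_upper_factor_matrix:
  assumes "module K A" "multilinear_family K H A q" "\<beta> ` {1..m} \<subseteq> carrier H"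
  shows "strict_upper_matrix A m (factor_matrix A q \<beta>)"
proof -
  interpret A: module K A by fact
  have "q (map \<beta> [Suc i..<Suc j]) \<in> carrier A" if "i < j" "j \<le> m" for i j
    using that assms(3) by (intro multilinear_family_carrier[OF assms(2)]) (auto simp: image_subset_iff)
  then show ?thesis by (auto simp: strict_upper_matrix_def factor_matrix_def)
qed

text \<open>
  Reindexed by step lengths, the sum over paths is the right hand side of the morphism equation
  for \<open>q\<close> at the word \<open>\<beta> (i + 1), \<dots>, \<beta> j\<close>.
\<close>

lemma matrix_diff_factor_matrix:
  assumes "module K A" "multilinear_family K A A b" "A_infinity_morphism K H bH A b q"
    and "grade H ` UNIV \<subseteq> Pow (carrier H)"
    and "\<And>k. k \<in> {1..m} \<Longrightarrow> \<beta> k \<in> grade H (e k)"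
    and "i < j" "j \<le> m"
  shows "matrix_diff A b m (factor_matrix A q \<beta>) i j =
    insertion_sum A q bH (map e [Suc i..<Suc j]) (map \<beta> [Suc i..<Suc j])"
proof -
  interpret A: module K A by fact
  let ?a = "factor_matrix A q \<beta>"
  let ?xs = "map \<beta> [Suc i..<Suc j]"
  have q: "multilinear_family K H A q" using assms(3) by (simp add: A_infinity_morphism_def)
  have \<beta>: "\<beta> ` {1..m} \<subseteq> carrier H" using assms(4,5) by blast
  have upper: "strict_upper_matrix A m ?a"
    by (rule strict_upper_factor_matrix[OF assms(1) q \<beta>])
  have word: "homogeneous_word H (map e [Suc i..<Suc j]) ?xs"
    unfolding homogeneous_word_def
    using assms(5,7) by (auto simp: list_all2_conv_all_nth simp del: upt_Suc)
  have eq: "b (map q (blocks (gaps i ks j) ?xs)) = b (map2 ?a (i # ks) (ks @ [j]))"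
    if "ks \<in> paths i j" for ks
    by (subst map_blocks_gaps[OF that, where a = ?a]) (auto simp: factor_matrix_def)
  have carr: "b (map2 ?a (i # ks) (ks @ [j])) \<in> carrier A" if ks: "ks \<in> paths i j" for ks
  proof (rule multilinear_family_carrier[OF assms(2)])
    have "set ks \<subseteq> {0..m}"
      using ks assms(7) by (force simp: paths_def sorted_wrt_append)
    then show "set (map2 ?a (i # ks) (ks @ [j])) \<subseteq> carrier A"
      using upper assms(6,7)
      by (intro set_map2_subset[of "{0..m}" "{0..m}"]) (auto simp: strict_upper_matrix_def)
    show "map2 ?a (i # ks) (ks @ [j]) \<noteq> []" by (cases ks) auto
  qed
  have bij: "bij_betw (\<lambda>ks. gaps i ks j) (paths i j) (compositions (j - i))"
    by (rule gaps_bij[OF assms(6)])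
  have "insertion_sum A q bH (map e [Suc i..<Suc j]) ?xs =
      finsum A (\<lambda>is. b (map q (blocks is ?xs))) (compositions (length ?xs))"
    using assms(3,6) word unfolding A_infinity_morphism_def by (auto simp del: upt_Suc)
  also have "\<dots> = finsum A (\<lambda>is. b (map q (blocks is ?xs))) ((\<lambda>ks. gaps i ks j) ` paths i j)"
    using bij by (simp add: bij_betw_def del: upt_Suc)
  also have "\<dots> = finsum A (\<lambda>ks. b (map q (blocks (gaps i ks j) ?xs))) (paths i j)"
  proof (rule A.finsum_reindex)
    show "(\<lambda>is. b (map q (blocks is ?xs))) \<in> (\<lambda>ks. gaps i ks j) ` paths i j \<rightarrow> carrier A"
      using eq carr by auto
    show "inj_on (\<lambda>ks. gaps i ks j) (paths i j)"
      using bij by (simp add: bij_betw_def)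
  qed
  also have "\<dots> = finsum A (\<lambda>ks. b (map2 ?a (i # ks) (ks @ [j]))) (paths i j)"
    using eq carr by (intro A.finsum_cong') (auto simp del: upt_Suc)
  also have "\<dots> = matrix_diff A b m ?a i j"
    using matrix_diff_eq_sum_paths[OF assms(1,2) upper] assms(6,7) by simp
  finally show ?thesis by simp
qed

text \<open>
  Inserting a vanishing value of \<open>bH\<close> puts a zero letter into an argument of \<open>q\<close>.  The surviving
  term, with the whole word as its factor, has no letters before the factor and hence no sign.
\<close>

lemma insertion_sum_of_vanishing_proper_factors:
  assumes "module K H" "module K A" "multilinear_family K H A q"
    and "xs \<noteq> []" "set xs \<subseteq> carrier H" "bH xs \<in> carrier H"
    and "\<And>r s. 1 \<le> s \<Longrightarrow> r + s \<le> length xs \<Longrightarrow> s < length xs \<Longrightarrow>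
      bH (take s (drop r xs)) = \<zero>\<^bsub>H\<^esub>"
  shows "insertion_sum A q bH ds xs = q [bH xs]"
proof -
  interpret H: module K H by fact
  interpret A: module K A by fact
  let ?T = "{(r, s, t). 1 \<le> s \<and> r + s + t = length xs}"
  define f where "f = (\<lambda>(r, s, t :: nat). sgn_pow A (sum_list (take r ds))
    (q (take r xs @ [bH (take s (drop r xs))] @ drop (r + s) xs)))"
  have fin: "finite ?T"
    by (rule finite_subset[of _ "{0..length xs} \<times> {0..length xs} \<times> {0..length xs}"]) auto
  have full: "f (0, length xs, 0) = q [bH xs]"
    by (simp add: f_def sgn_pow_def)
  have carr: "q [bH xs] \<in> carrier A"
    using assms(6) by (intro multilinear_family_carrier[OF assms(3)]) auto
  have zero: "f p = \<zero>\<^bsub>A\<^esub>" if p_in: "p \<in> ?T - {(0, length xs, 0)}" for p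
  proof -
    obtain r s t where p: "p = (r, s, t)" "1 \<le> s" "r + s + t = length xs" "s < length xs"
      using p_in by (cases p) auto
    have "q (take r xs @ [\<zero>\<^bsub>H\<^esub>] @ drop (r + s) xs) = \<zero>\<^bsub>A\<^esub>"
      using assms(5) set_take_subset[of r xs] set_drop_subset[of "r + s" xs]
      by (intro multilinear_family_zero[OF assms(1-3)]) auto
    then show ?thesis using p assms(7)[of s r] by (simp add: f_def sgn_pow_def)
  qed
  have "f p \<in> carrier A" if "p \<in> ?T" for p
    using carr full zero[of p] that by (cases "p = (0, length xs, 0)") auto
  then have closed: "f \<in> ?T \<rightarrow> carrier A" by blast
  have "insertion_sum A q bH ds xs = finsum A f ?T"
    by (simp add: insertion_sum_def f_def)
  also have "\<dots> = finsum A f {(0, length xs, 0)}"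
    using assms(4)
    by (intro A.add.finprod_mono_neutral_cong_right[OF fin _ zero _ closed]) (auto simp: Suc_le_eq)
  also have "\<dots> = q [bH xs]"
    using carr full by simp
  finally show ?thesis .
qed

text \<open>
  The values of \<open>q\<close> on the factors of the word form the defining system.  Changing its corner entry
  would change the value of the system by a coboundary only; taking the value of \<open>q\<close> on the whole
  word there makes the morphism equation apply to the corner as well.
\<close>

lemma transferred_product_in_massey_product:
  fixes A :: "('k, 'a) graded_module" and b :: "'a list \<Rightarrow> 'a"
  defines "H \<equiv> cohomology A b"
  assumes "A_infinity K N A b" "A_infinity K N H bb" "A_infinity_morphism K H bb A b q"
    and q1: "\<And>\<gamma>. \<gamma> \<in> carrier H \<Longrightarrow> coh_class A b (q [\<gamma>]) = \<gamma>"
    and "1 \<le> m" and \<beta>: "\<And>k. k \<in> {1..m} \<Longrightarrow> \<beta> k \<in> grade H (e k)"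
    and vanish: "\<And>i j. i < j \<Longrightarrow> j \<le> m \<Longrightarrow> j - i < m \<Longrightarrow> bb (map \<beta> [Suc i..<Suc j]) = \<zero>\<^bsub>H\<^esub>"
  shows "massey_defined A b m \<beta>" "bb (map \<beta> [1..<Suc m]) \<in> massey_product A b m \<beta>"
proof -
  have modA: "module K A" and modH: "module K H"
    and b: "multilinear_family K A A b" and bb: "multilinear_family K H H bb"
    and q: "multilinear_family K H A q"
    using assms(2-4) by (auto simp: A_infinity_def graded_vector_space_def A_infinity_morphism_def)
  interpret A: module K A by fact
  interpret H: module K H by fact
  have grade: "grade H ` UNIV \<subseteq> Pow (carrier H)"
    by (auto simp: H_def cohomology_def)
  then have \<beta>_carrier: "\<beta> ` {1..m} \<subseteq> carrier H" using \<beta> by blast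
  let ?a = "factor_matrix A q \<beta>"
  have upper: "strict_upper_matrix A m ?a"
    by (rule strict_upper_factor_matrix[OF modA q \<beta>_carrier])
  have factor: "bb (map \<beta> [Suc i..<Suc j]) \<in> carrier H" if "i < j" "j \<le> m" for i j
    using that \<beta>_carrier by (intro multilinear_family_carrier[OF bb]) (auto simp: image_subset_iff)
  have entry: "matrix_diff A b m ?a i j = q [bb (map \<beta> [Suc i..<Suc j])]"
    if ij: "i < j" "j \<le> m" for i j
  proof -
    let ?xs = "map \<beta> [Suc i..<Suc j]"
    have "bb (take s (drop r ?xs)) = \<zero>\<^bsub>H\<^esub>"
      if "1 \<le> s" "r + s \<le> length ?xs" "s < length ?xs" for r s
    proof -
      have "take s (drop r ?xs) = map \<beta> [Suc (i + r)..<Suc (i + r + s)]"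
        using that by (simp add: take_map drop_map del: upt_Suc)
      then show ?thesis
        using vanish[of "i + r" "i + r + s"] that ij by (simp del: upt_Suc)
    qed
    then have "insertion_sum A q bb (map e [Suc i..<Suc j]) ?xs = q [bb ?xs]"
      using ij \<beta>_carrier factor[OF ij]
      by (intro insertion_sum_of_vanishing_proper_factors[OF modH modA q]) (auto simp: image_subset_iff)
    then show ?thesis
      using matrix_diff_factor_matrix[where \<beta> = \<beta>, OF modA b assms(4) grade \<beta> ij] by simp
  qed
  have "matrix_diff A b m ?a i j = \<zero>\<^bsub>A\<^esub>" if "i \<le> m" "j \<le> m" "(i, j) \<noteq> (0, m)" for i j
  proof (cases "i < j")
    case True
    then have "j - i < m" using that by (cases "i = 0") auto
    then have "matrix_diff A b m ?a i j = q [\<zero>\<^bsub>H\<^esub>]"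
      using entry[OF True that(2)] vanish[OF True that(2)] by simp
    also have "\<dots> = \<zero>\<^bsub>A\<^esub>"
      by (rule multilinear_family_zero[OF modH modA q]) auto
    finally show ?thesis .
  next
    case False
    then have "paths i j = {}" using path_less by blast
    then show ?thesis using matrix_diff_eq_sum_paths[OF modA b upper that(1,2)] by simp
  qed
  moreover have "coh_class A b (?a (i - 1) i) = \<beta> i" if "i \<in> {1..m}" for i
  proof -
    have "\<beta> i \<in> carrier H" using that \<beta>_carrier by blast
    moreover have "[Suc (i - 1)..<Suc i] = [i]" using that by (simp add: upt_rec)
    ultimately show ?thesis using that q1 by (simp add: factor_matrix_def del: upt_Suc)
  qed
  ultimately have sys: "defining_system A b m \<beta> ?a"
    using upper by (auto simp: defining_system_def)
  then show "massey_defined A b m \<beta>"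
    by (auto simp: massey_defined_def)
  have "coh_class A b (matrix_diff A b m ?a 0 m) = bb (map \<beta> [1..<Suc m])"
    using entry[of 0 m] q1[OF factor[of 0 m]] \<open>1 \<le> m\<close> by (simp del: upt_Suc)
  then show "bb (map \<beta> [1..<Suc m]) \<in> massey_product A b m \<beta>"
    using sys unfolding massey_product_def by force
qed

section \<open>Massey products of shuffles\<close>

theorem proposition4p19:
  fixes K :: "('k, 'c) ring_scheme"
    and N :: int
    and A :: "('k, 'a) graded_module"
    and b :: "'a list \<Rightarrow> 'a"
    and bb :: "'a set list \<Rightarrow> 'a set"
    and \<alpha> :: "nat \<Rightarrow> 'a set"
    and d :: "nat \<Rightarrow> int"
    and m r :: nat
  assumes "C_infinity K N A b"
    and "transferred_C_infinity K N A b bb"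
    and "2 \<le> m" and "0 < r" and "r < m"
    and "\<forall>i \<in> {1..m}. \<alpha> i \<in> grade (cohomology A b) (d i)"
    and "\<forall>\<sigma> \<in> shuffle_perms r m. \<forall>i \<le> m. \<forall>j \<le> m. i < j \<and> j - i < m \<longrightarrow>
           bb (map (\<lambda>k. \<alpha> (\<sigma> k)) [Suc i..<Suc j]) = \<zero>\<^bsub>cohomology A b\<^esub>"
  shows "(\<forall>\<sigma> \<in> shuffle_perms r m. massey_defined A b m (\<lambda>k. \<alpha> (\<sigma> k))) \<and>
    \<zero>\<^bsub>cohomology A b\<^esub> \<in>
      sum_of_subsets (cohomology A b)
        (\<lambda>\<sigma>. sgn_pow (cohomology A b) (shuffle_exponent r m d \<sigma>) `
                massey_product A b m (\<lambda>k. \<alpha> (\<sigma> k)))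
        (shuffle_perms r m)"
proof -
  let ?H = "cohomology A b"
  let ?w = "\<lambda>\<sigma>. bb (map (\<lambda>k. \<alpha> (\<sigma> k)) [1..<Suc m])"
  have A: "A_infinity K N A b"
    using assms(1) by (simp add: C_infinity_def)
  have C: "C_infinity K N ?H bb" and H: "A_infinity K N ?H bb"
    using assms(2) by (simp_all add: transferred_C_infinity_def C_infinity_def)
  obtain q where q: "A_infinity_morphism K ?H bb A b q"
    "\<And>\<gamma>. \<gamma> \<in> carrier ?H \<Longrightarrow> coh_class A b (q [\<gamma>]) = \<gamma>"
  proof -
    have "\<exists>q. A_infinity_quasi_iso K ?H bb A b q \<and>
        (\<forall>\<gamma> \<in> carrier ?H. q [\<gamma>] \<in> cocycles A b \<and> coh_class A b (q [\<gamma>]) = \<gamma>)"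
      using assms(2) by (simp only: transferred_C_infinity_def)
    then show ?thesis using that by (auto simp: A_infinity_quasi_iso_def)
  qed
  have massey: "massey_defined A b m (\<lambda>k. \<alpha> (\<sigma> k)) \<and>
      ?w \<sigma> \<in> massey_product A b m (\<lambda>k. \<alpha> (\<sigma> k))" if \<sigma>: "\<sigma> \<in> shuffle_perms r m" for \<sigma>
  proof -
    have "\<sigma> permutes {1..m}" using \<sigma> by (simp add: shuffle_perms_def)
    then have "\<sigma> k \<in> {1..m}" if "k \<in> {1..m}" for k
      using that by (simp only: permutes_in_image)
    then have letters: "\<alpha> (\<sigma> k) \<in> grade ?H (d (\<sigma> k))" if "k \<in> {1..m}" for k
      using that assms(6) by blast
    have vanish: "bb (map (\<lambda>k. \<alpha> (\<sigma> k)) [Suc i..<Suc j]) = \<zero>\<^bsub>?H\<^esub>"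
      if "i < j" "j \<le> m" "j - i < m" for i j
      using assms(7)[rule_format, OF \<sigma>, of i j] that by simp
    have "1 \<le> m" using assms(3) by simp
    show ?thesis
      using transferred_product_in_massey_product[where \<beta> = "\<lambda>k. \<alpha> (\<sigma> k)"
          and e = "\<lambda>k. d (\<sigma> k)", OF A H q \<open>1 \<le> m\<close> letters vanish]
      by (intro conjI)
  qed
  have "finsum ?H (\<lambda>\<sigma>. sgn_pow ?H (shuffle_exponent r m d \<sigma>) (?w \<sigma>)) (shuffle_perms r m) = \<zero>\<^bsub>?H\<^esub>"
    using conjunct2[OF C[unfolded C_infinity_def], rule_format, of m r \<alpha> d] assms(3-6) by simp
  then have "\<zero>\<^bsub>?H\<^esub> \<in> sum_of_subsets ?H
        (\<lambda>\<sigma>. sgn_pow ?H (shuffle_exponent r m d \<sigma>) `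
                massey_product A b m (\<lambda>k. \<alpha> (\<sigma> k)))
        (shuffle_perms r m)"
    unfolding sum_of_subsets_def
    by (intro CollectI exI[of _ "\<lambda>\<sigma>. sgn_pow ?H (shuffle_exponent r m d \<sigma>) (?w \<sigma>)"])
      (use massey in auto)
  then show ?thesis using massey by blast
qed

end
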